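(* Let $F$ be a finite extension of $\mathbb{Q}_p$ and $R$ a commutative ring. Then $C_c(\tilde{\mathcal{V}},R)$ is a free module over the commutative ring $R[T,\mathcal{R}^{\pm1}]$ generated over $R$ by the commuting operators $T$, $\mathcal{R}$ and $\mathcal{R}^{-1}$ (polynomials in $T$ and Laurent polynomials in $\mathcal{R}$).
   Context: $\mathcal{O}_F$ is the ring of integers, $\varpi$ a uniformizer, $\mathfrak{p}=(\varpi)$. $\tilde{\mathcal{V}}$ is the set of lattices in $F^2$ (finitely generated $\mathcal{O}_F$-submodules isomorphic to $\mathcal{O}_F^2$ spanning $F^2$). $C_c(\tilde{\mathcal{V}},R)$ is the $R$-module of functions $\tilde{\mathcal{V}}\to R$ with finite support. The Hecke operators are $(T\phi)(v)=\sum_{v'}\phi(v')$, the sum over the $q+1$ lattices $v'\subseteq v$ with $v/v'\cong\mathcal{O}_F/\mathfrak{p}$, and $(\mathcal{R}\phi)(v)=\phi(\varpi^{-1}v)$; these commute and $\mathcal{R}$ is invertible. *)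

theory Defs
  imports Main "HOL-Computational_Algebra.Primes"
begin

text \<open>F is modelled as a type of characteristic 0 carrying a normalized discrete
  valuation val (val x only meaningful for x \<noteq> 0), which is complete, has
  ring of integers O with finite residue field of characteristic p.  By the
  classification of local fields these are exactly the finite extensions of Q_p.\<close>

definition in_O :: "('a::field \<Rightarrow> int) \<Rightarrow> 'a \<Rightarrow> bool" where
  "in_O val x \<longleftrightarrow> x = 0 \<or> val x \<ge> 0"

definition in_P :: "('a::field \<Rightarrow> int) \<Rightarrow> 'a \<Rightarrow> bool" where
  "in_P val x \<longleftrightarrow> x = 0 \<or> val x \<ge> 1"

definition discrete_valuation :: "('a::field \<Rightarrow> int) \<Rightarrow> bool" where
  "discrete_valuation val \<longleftrightarrow>
     (\<forall>x y. x \<noteq> 0 \<longrightarrow> y \<noteq> 0 \<longrightarrow> val (x * y) = val x + val y) \<and>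
     (\<forall>x y. x \<noteq> 0 \<longrightarrow> y \<noteq> 0 \<longrightarrow> x + y \<noteq> 0 \<longrightarrow> val (x + y) \<ge> min (val x) (val y)) \<and>
     (\<forall>n. \<exists>x. x \<noteq> 0 \<and> val x = n)"

definition val_cauchy :: "('a::field \<Rightarrow> int) \<Rightarrow> (nat \<Rightarrow> 'a) \<Rightarrow> bool" where
  "val_cauchy val s \<longleftrightarrow>
     (\<forall>N::int. \<exists>M. \<forall>m\<ge>M. \<forall>n\<ge>M. s m = s n \<or> val (s m - s n) \<ge> N)"

definition val_converges :: "('a::field \<Rightarrow> int) \<Rightarrow> (nat \<Rightarrow> 'a) \<Rightarrow> 'a \<Rightarrow> bool" where
  "val_converges val s L \<longleftrightarrow>
     (\<forall>N::int. \<exists>M. \<forall>n\<ge>M. s n = L \<or> val (s n - L) \<ge> N)"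

definition p_adic_field :: "nat \<Rightarrow> ('a::field_char_0 \<Rightarrow> int) \<Rightarrow> bool" where
  "p_adic_field p val \<longleftrightarrow>
     prime p \<and> discrete_valuation val \<and>
     (\<forall>s. val_cauchy val s \<longrightarrow> (\<exists>L. val_converges val s L)) \<and>
     in_P val (of_nat p) \<and>
     (\<exists>S. finite S \<and> (\<forall>s\<in>S. in_O val s) \<and>
          (\<forall>x. in_O val x \<longrightarrow> (\<exists>s\<in>S. in_P val (x - s))))"

definition vadd :: "'a::field \<times> 'a \<Rightarrow> 'a \<times> 'a \<Rightarrow> 'a \<times> 'a" where
  "vadd u w = (fst u + fst w, snd u + snd w)"

definition smul :: "'a::field \<Rightarrow> 'a \<times> 'a \<Rightarrow> 'a \<times> 'a" where
  "smul a u = (a * fst u, a * snd u)"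

definition lattice :: "('a::field \<Rightarrow> int) \<Rightarrow> ('a \<times> 'a) set \<Rightarrow> bool" where
  "lattice val L \<longleftrightarrow> (\<exists>e1 e2. fst e1 * snd e2 - snd e1 * fst e2 \<noteq> 0 \<and>
      L = {vadd (smul a e1) (smul b e2) | a b. in_O val a \<and> in_O val b})"

text \<open>v' is a lattice, v' \<subseteq> v and v/v' \<cong> O/p: there is a surjective O-linear map
  v \<rightarrow> O/p (represented by a function v \<rightarrow> O read modulo p) with kernel v'.\<close>
definition index_p_sub :: "('a::field \<Rightarrow> int) \<Rightarrow> ('a \<times> 'a) set \<Rightarrow> ('a \<times> 'a) set \<Rightarrow> bool" where
  "index_p_sub val v' v \<longleftrightarrow> lattice val v' \<and> v' \<subseteq> v \<and>
     (\<exists>h. (\<forall>x\<in>v. in_O val (h x)) \<and>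
          (\<forall>x\<in>v. \<forall>y\<in>v. in_P val (h (vadd x y) - h x - h y)) \<and>
          (\<forall>a x. in_O val a \<longrightarrow> x \<in> v \<longrightarrow> in_P val (h (smul a x) - a * h x)) \<and>
          (\<forall>x\<in>v. in_P val (h x) \<longleftrightarrow> x \<in> v') \<and>
          (\<forall>a. in_O val a \<longrightarrow> (\<exists>x\<in>v. in_P val (h x - a))))"

text \<open>Functions on lattices are functions on all subsets of F^2 vanishing off lattices.\<close>
definition Cc :: "('a::field \<Rightarrow> int) \<Rightarrow> (('a \<times> 'a) set \<Rightarrow> 'r::comm_ring_1) set" where
  "Cc val = {\<phi>. finite {v. \<phi> v \<noteq> 0} \<and> (\<forall>v. \<phi> v \<noteq> 0 \<longrightarrow> lattice val v)}"

definition hecke_T :: "('a::field \<Rightarrow> int) \<Rightarrow> (('a \<times> 'a) set \<Rightarrow> 'r::comm_ring_1) \<Rightarrow> (('a \<times> 'a) set \<Rightarrow> 'r)" where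
  "hecke_T val \<phi> v = (if lattice val v then (\<Sum>v'\<in>{v'. index_p_sub val v' v}. \<phi> v') else 0)"

definition hecke_R :: "'a::field \<Rightarrow> (('a \<times> 'a) set \<Rightarrow> 'r::comm_ring_1) \<Rightarrow> (('a \<times> 'a) set \<Rightarrow> 'r)" where
  "hecke_R unif \<phi> v = \<phi> (smul (inverse unif) ` v)"

definition hecke_R_inv :: "'a::field \<Rightarrow> (('a \<times> 'a) set \<Rightarrow> 'r::comm_ring_1) \<Rightarrow> (('a \<times> 'a) set \<Rightarrow> 'r)" where
  "hecke_R_inv unif \<phi> v = \<phi> (smul unif ` v)"

definition hecke_R_pow :: "'a::field \<Rightarrow> int \<Rightarrow> (('a \<times> 'a) set \<Rightarrow> 'r::comm_ring_1) \<Rightarrow> (('a \<times> 'a) set \<Rightarrow> 'r)" where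
  "hecke_R_pow unif k = (if 0 \<le> k then hecke_R unif ^^ nat k else hecke_R_inv unif ^^ nat (- k))"

definition mono_act :: "('a::field \<Rightarrow> int) \<Rightarrow> 'a \<Rightarrow> nat \<Rightarrow> int \<Rightarrow>
     (('a \<times> 'a) set \<Rightarrow> 'r::comm_ring_1) \<Rightarrow> (('a \<times> 'a) set \<Rightarrow> 'r)" where
  "mono_act val unif m k \<phi> = (hecke_T val ^^ m) (hecke_R_pow unif k \<phi>)"

text \<open>Freeness over R[T,R^{+-1}]: an element of R[T,R^{+-1}] is a finitely supported
  coefficient function nat \<times> int \<Rightarrow> R; B is a basis iff every \<phi> in C_c is a unique
  finite combination  \<Sum> P_b(T,R) b  with b \<in> B.\<close>
definition free_over_TR :: "('a::field \<Rightarrow> int) \<Rightarrow> 'a \<Rightarrow> (('a \<times> 'a) set \<Rightarrow> 'r::comm_ring_1) set \<Rightarrow> bool" where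
  "free_over_TR val unif M \<longleftrightarrow>
    (\<exists>B \<subseteq> M. \<forall>\<phi>\<in>M. \<exists>!c :: (('a \<times> 'a) set \<Rightarrow> 'r) \<Rightarrow> nat \<times> int \<Rightarrow> 'r.
        finite {(b, mk). c b mk \<noteq> 0} \<and>
        (\<forall>b mk. c b mk \<noteq> 0 \<longrightarrow> b \<in> B) \<and>
        \<phi> = (\<lambda>v. \<Sum>(b, mk)\<in>{(b, mk). c b mk \<noteq> 0}.
                   c b mk * mono_act val unif (fst mk) (snd mk) b v))"

end

theory Submission
  imports Defs "HOL-Library.Product_Lexorder"
begin

text \<open>
  Let \<open>depth L\<close> be the largest \<open>n\<close> such that \<open>L\<close> is contained in the \<open>n\<close>-th power of the uniformizer
  times the standard lattice, and let \<open>lev L\<close> be the valuation of the determinant of a basis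
  of \<open>L\<close> minus \<open>2 * depth L\<close>; this is the distance from the homothety class of \<open>L\<close> to that of the
  standard lattice in the Bruhat-Tits tree. The operator \<open>T\<close> maps the indicator of a lattice \<open>w\<close> to the
  sum of the indicators of the lattices containing \<open>w\<close> with index \<open>q\<close>. Each of them has level
  \<open>lev w + 1\<close> (a child of \<open>w\<close>) or \<open>lev w - 1\<close>, and every lattice of positive level has exactly one
  parent. Hence on top level \<open>T ^ m\<close> maps \<open>w\<close> to the sum of its descendants \<open>m\<close> generations below.

  Choose a favourite child of every lattice, compatibly with scaling. The lattices of depth 0 that are
  not favourite children give a basis: every lattice is reached from a unique such \<open>b\<close> by scaling
  and then passing \<open>m\<close> times to the favourite child, and the remaining top-level terms of
  \<open>T ^ m\<close> are reached by passing fewer than \<open>m\<close> times to the favourite child. So the family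
  \<open>T ^ m R ^ k b\<close> is unitriangular with respect to the indicators of lattices.
\<close>

section \<open>Unitriangular families over a commutative ring\<close>

text \<open>Existence is well-founded induction on \<open>rank\<close>: \<open>f i\<close> differs
  from the indicator of \<open>lead i\<close> by a combination of indicators of leading points of
  smaller rank. Uniqueness looks at an index of maximal rank in a vanishing combination. Both work
  over any ring because the leading coefficients are 1.\<close>

lemma triangular_basis:
  fixes f :: "'i \<Rightarrow> 'x \<Rightarrow> 'r::comm_ring_1" and rank :: "'i \<Rightarrow> 'w::wellorder"
  assumes fin: "\<And>i. i \<in> I \<Longrightarrow> finite {x. f i x \<noteq> 0}"
    and supp: "\<And>i x. i \<in> I \<Longrightarrow> f i x \<noteq> 0 \<Longrightarrow> x \<in> lead ` I"
    and one: "\<And>i. i \<in> I \<Longrightarrow> f i (lead i) = 1"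
    and tri: "\<And>i j. i \<in> I \<Longrightarrow> j \<in> I \<Longrightarrow> f i (lead j) \<noteq> 0 \<Longrightarrow> j = i \<or> rank j < rank i"
    and g: "finite {x. g x \<noteq> 0}" "\<And>x. g x \<noteq> 0 \<Longrightarrow> x \<in> lead ` I"
  shows "\<exists>!c. finite {i. c i \<noteq> 0} \<and> (\<forall>i. c i \<noteq> 0 \<longrightarrow> i \<in> I) \<and>
    g = (\<lambda>x. \<Sum>i\<in>{i. c i \<noteq> 0}. c i * f i x)"
proof -
  define comb where "comb c x = (\<Sum>i\<in>{i. c i \<noteq> 0}. c i * f i x)" for c x
  have comb_superset: "comb c x = (\<Sum>i\<in>A. c i * f i x)" if "finite A" "{i. c i \<noteq> 0} \<subseteq> A" for c x A
    unfolding comb_def using that by (intro sum.mono_neutral_left) auto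
  define fs where "fs c \<longleftrightarrow> finite {i. c i \<noteq> 0} \<and> (\<forall>i. c i \<noteq> 0 \<longrightarrow> i \<in> I)" for c :: "'i \<Rightarrow> 'r"
  \<comment> \<open>This one form yields sums, multiples and differences; all sums are taken over
    the union of the two supports.\<close>
  have comb_lin: "fs (\<lambda>i. c i + r * d i) \<and> comb (\<lambda>i. c i + r * d i) = (\<lambda>x. comb c x + r * comb d x)"
    if "fs c" "fs d" for c d r
  proof
    let ?A = "{i. c i \<noteq> 0} \<union> {i. d i \<noteq> 0}"
    have A: "finite ?A" "{i. c i + r * d i \<noteq> 0} \<subseteq> ?A"
      using that by (auto simp: fs_def)
    then show "fs (\<lambda>i. c i + r * d i)"
      using that finite_subset unfolding fs_def by blast
    show "comb (\<lambda>i. c i + r * d i) = (\<lambda>x. comb c x + r * comb d x)"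
    proof
      fix x
      have "comb (\<lambda>i. c i + r * d i) x = (\<Sum>i\<in>?A. c i * f i x + r * (d i * f i x))"
        using comb_superset[OF A] by (simp add: distrib_right mult.assoc)
      also have "\<dots> = comb c x + r * comb d x"
        using comb_superset[OF A(1), of c] comb_superset[OF A(1), of d]
        by (simp add: sum.distrib sum_distrib_left)
      finally show "comb (\<lambda>i. c i + r * d i) x = comb c x + r * comb d x" .
    qed
  qed
  define spanned where "spanned h \<longleftrightarrow> (\<exists>c. fs c \<and> h = comb c)" for h
  have span_lin: "spanned (\<lambda>x. h x + r * k x)" if "spanned h" "spanned k" for h k r
  proof -
    obtain c d where "fs c" "h = comb c" "fs d" "k = comb d"
      using \<open>spanned h\<close> \<open>spanned k\<close> by (auto simp: spanned_def)
    then show ?thesis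
      unfolding spanned_def using comb_lin[of c d r] by (intro exI[of _ "\<lambda>i. c i + r * d i"]) simp
  qed
  have span_zero: "spanned (\<lambda>_. 0)"
    unfolding spanned_def by (rule exI[of _ "\<lambda>_. 0"]) (simp add: fs_def comb_def fun_eq_iff)
  have span_sum: "spanned (\<lambda>x. \<Sum>y\<in>A. r y * k y x)" if "finite A" "\<And>y. y \<in> A \<Longrightarrow> spanned (k y)" for A r k
    using that
  proof (induction A rule: finite_induct)
    case (insert y A)
    then have "spanned (\<lambda>x. (\<Sum>y\<in>A. r y * k y x) + r y * k y x)"
      by (intro span_lin) auto
    then show ?case
      using insert by (simp add: add.commute)
  qed (simp add: span_zero)
  have span_f: "spanned (f i)" if "i \<in> I" for i
    unfolding spanned_def
  proof (intro exI conjI)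
    let ?c = "\<lambda>j. if j = i then 1 else 0 :: 'r"
    show "fs ?c"
      using that by (auto simp: fs_def)
    show "f i = comb ?c"
      by (simp add: fun_eq_iff comb_superset[of "{i}"])
  qed
  define ind where "ind y x = (if x = y then 1 else 0 :: 'r)" for y x :: 'x
  have decomp: "h = (\<lambda>x. \<Sum>y\<in>A. h y * ind y x)" if "finite A" "\<And>x. x \<notin> A \<Longrightarrow> h x = 0" for h A
    using that by (auto simp: ind_def fun_eq_iff if_distrib cong: if_cong)
  have span_ind: "spanned (ind (lead i))" if "i \<in> I" for i
    using that
  proof (induction i rule: measure_induct_rule[where f = rank])
    case (less i)
    let ?A = "{x. f i x \<noteq> 0} - {lead i}"
    \<comment> \<open>\<open>f i\<close> is solved for its leading term. Every other point of its
      support is the leading point of a \<open>j\<close> with smaller rank, where the induction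
      hypothesis applies.\<close>
    have eq: "ind (lead i) = (\<lambda>x. f i x + (- 1) * (\<Sum>y\<in>?A. f i y * ind y x))"
    proof
      fix x
      have "(\<lambda>x. f i x - ind (lead i) x) = (\<lambda>x. \<Sum>y\<in>?A. (f i y - ind (lead i) y) * ind y x)"
        using fin one less.prems by (intro decomp) (auto simp: ind_def)
      also have "\<dots> = (\<lambda>x. \<Sum>y\<in>?A. f i y * ind y x)"
        by (auto simp: fun_eq_iff ind_def intro!: sum.cong)
      finally have "f i x - ind (lead i) x = (\<Sum>y\<in>?A. f i y * ind y x)"
        by meson
      then show "ind (lead i) x = f i x + (- 1) * (\<Sum>y\<in>?A. f i y * ind y x)"
        by (simp add: algebra_simps)
    qed
    have "spanned (ind y)" if y: "y \<in> ?A" for y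
    proof -
      obtain j where "j \<in> I" "y = lead j"
        using y supp less.prems by blast
      then show ?thesis
        using less tri[of i j] y by auto
    qed
    then show ?case
      unfolding eq using fin less.prems
      by (intro span_lin[of "f i" "\<lambda>x. \<Sum>y\<in>?A. f i y * ind y x"] span_f span_sum) auto
  qed
  have "spanned (\<lambda>x. \<Sum>y\<in>{x. g x \<noteq> 0}. g y * ind y x)"
    using g span_ind by (intro span_sum) auto
  then have "spanned g"
    using decomp[OF g(1)] by simp
  then obtain c where c: "fs c" "g = comb c"
    by (auto simp: spanned_def)
  have zero: "c = (\<lambda>_. 0)" if c: "fs c" "comb c = (\<lambda>_. 0)" for c
  proof (rule ccontr)
    assume "c \<noteq> (\<lambda>_. 0)"
    then have ne: "{i. c i \<noteq> 0} \<noteq> {}" and fin_c: "finite {i. c i \<noteq> 0}"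
      using c by (auto simp: fs_def)
    define m where "m = Max (rank ` {i. c i \<noteq> 0})"
    have "m \<in> rank ` {i. c i \<noteq> 0}"
      unfolding m_def using ne fin_c by (intro Max_in) auto
    then obtain i where i: "c i \<noteq> 0" "rank i = m"
      by auto
    have max: "rank j \<le> m" if "c j \<noteq> 0" for j
      unfolding m_def using fin_c that by (intro Max_ge) auto
    \<comment> \<open>A nonzero \<open>f j (lead i)\<close> with \<open>j \<noteq> i\<close> would
      need \<open>rank i < rank j\<close>, against maximality; so only \<open>c i\<close> survives
      at \<open>lead i\<close>.\<close>
    have "c j * f j (lead i) = 0" if "j \<in> {i. c i \<noteq> 0} - {i}" for j
      using that tri[of j i] max[of j] i c(1) by (fastforce simp: fs_def)
    then have "comb c (lead i) = c i * f i (lead i)"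
      unfolding comb_def using fin_c i by (subst sum.remove[of _ i]) auto
    then show False
      using c i one by (auto simp: fs_def)
  qed
  have unique: "d = c" if d: "fs d" "g = comb d" for d
  proof -
    have "fs (\<lambda>i. d i + (- 1) * c i)" "comb (\<lambda>i. d i + (- 1) * c i) = (\<lambda>_. 0)"
      using comb_lin[OF d(1) c(1), of "- 1"] c d by auto
    then show ?thesis
      using zero[of "\<lambda>i. d i + (- 1) * c i"] by (simp add: fun_eq_iff)
  qed
  have "\<exists>!c. fs c \<and> g = comb c"
    using c unique by blast
  then show ?thesis
    by (simp only: fs_def comb_def[abs_def] conj_assoc)
qed

section \<open>Indicators and linear algebra in the plane\<close>

definition ind :: "'x \<Rightarrow> 'x \<Rightarrow> 'r::zero_neq_one" where
  "ind w v = (if v = w then 1 else 0)"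

lemma inj_ind: "inj (ind :: 'x \<Rightarrow> 'x \<Rightarrow> 'r::zero_neq_one)"
  by (rule injI) (metis ind_def zero_neq_one)

definition det2 :: "'a::field \<times> 'a \<Rightarrow> 'a \<times> 'a \<Rightarrow> 'a" where
  "det2 e f = fst e * snd f - snd e * fst f"

lemma vadd_simps [simp]: "fst (vadd u w) = fst u + fst w" "snd (vadd u w) = snd u + snd w"
  by (simp_all add: vadd_def)

lemma smul_simps [simp]: "fst (smul a u) = a * fst u" "snd (smul a u) = a * snd u"
  by (simp_all add: smul_def)

lemma smul_smul: "smul a (smul b u) = smul (a * b) u"
  by (simp add: smul_def mult.assoc)

lemma smul_one [simp]: "smul 1 u = u"
  by (simp add: smul_def)

lemma smul_vadd: "smul a (vadd u w) = vadd (smul a u) (smul a w)"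
  by (simp add: prod_eq_iff algebra_simps)

lemma det2_smul: "det2 (smul a e) f = a * det2 e f" "det2 e (smul a f) = a * det2 e f"
  by (simp_all add: det2_def algebra_simps)

lemma det2_comb:
  "det2 (vadd (smul a e) (smul b f)) (vadd (smul c e) (smul d f)) = (a * d - b * c) * det2 e f"
  by (simp add: det2_def algebra_simps)

text \<open>Cramer's rule: the inverse matrix is the adjugate divided by the determinant
  \<open>u\<close>, hence integral when the entries are integral and \<open>u\<close> is a
  unit.\<close>

lemma det2_comb_inverse:
  fixes a b c d :: "'a::field"
  defines "u \<equiv> a * d - b * c"
  assumes "u \<noteq> 0"
    and "f1 = vadd (smul a e1) (smul b e2)" "f2 = vadd (smul c e1) (smul d e2)"
  shows "e1 = vadd (smul (d / u) f1) (smul (- b / u) f2)"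
    and "e2 = vadd (smul (- c / u) f1) (smul (a / u) f2)"
proof -
  have "u * x = d * (a * x + b * y) - b * (c * x + d * y)"
    "u * y = a * (c * x + d * y) - c * (a * x + b * y)" for x y
    by (simp_all add: u_def algebra_simps)
  then have "x = (d * (a * x + b * y) - b * (c * x + d * y)) / u"
    "y = (a * (c * x + d * y) - c * (a * x + b * y)) / u" for x y
    using \<open>u \<noteq> 0\<close> by (metis nonzero_mult_div_cancel_left)+
  then have "x = (d / u) * (a * x + b * y) + (- b / u) * (c * x + d * y)"
    "y = (- c / u) * (a * x + b * y) + (a / u) * (c * x + d * y)" for x y
    by (simp_all add: diff_divide_distrib)
  then show "e1 = vadd (smul (d / u) f1) (smul (- b / u) f2)"
    "e2 = vadd (smul (- c / u) f1) (smul (a / u) f2)"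
    by (simp_all add: prod_eq_iff assms)
qed

lemma det2_coords_unique:
  assumes "det2 e1 e2 \<noteq> 0"
    and "vadd (smul a e1) (smul b e2) = vadd (smul c e1) (smul d e2)"
  shows "a = c" "b = d"
proof -
  have "fst e1 * (a - c) = fst e2 * (d - b)" "snd e1 * (a - c) = snd e2 * (d - b)"
    using assms(2) by (auto simp: prod_eq_iff algebra_simps)
  moreover have "(a - c) * det2 e1 e2 = (fst e1 * (a - c)) * snd e2 - (snd e1 * (a - c)) * fst e2"
    "(d - b) * det2 e1 e2 = fst e1 * (snd e2 * (d - b)) - snd e1 * (fst e2 * (d - b))"
    by (simp_all add: det2_def algebra_simps)
  ultimately have "(a - c) * det2 e1 e2 = fst e2 * (d - b) * snd e2 - snd e2 * (d - b) * fst e2"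
    "(d - b) * det2 e1 e2 = fst e1 * (snd e1 * (a - c)) - snd e1 * (fst e1 * (a - c))"
    by presburger+
  then have "(a - c) * det2 e1 e2 = 0" "(d - b) * det2 e1 e2 = 0"
    by simp_all
  then show "a = c" "b = d"
    using assms(1) by auto
qed

section \<open>Arithmetic of the valuation\<close>

locale val_field =
  fixes val :: "'a::field \<Rightarrow> int" and unif :: 'a
  assumes dv: "discrete_valuation val"
    and unif: "unif \<noteq> 0" "val unif = 1"
    and fin_res: "\<exists>S. finite S \<and> (\<forall>s\<in>S. in_O val s) \<and> (\<forall>x. in_O val x \<longrightarrow> (\<exists>s\<in>S. in_P val (x - s)))"
begin

text \<open>The zero element is given infinite valuation, so this is the fractional ideal generated
  by the \<open>n\<close>-th power of the uniformizer: the integers for 0, the maximal ideal for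
  1.\<close>

definition vge :: "int \<Rightarrow> 'a \<Rightarrow> bool" where
  "vge n x \<longleftrightarrow> x = 0 \<or> val x \<ge> n"

lemma in_O_vge: "in_O val x \<longleftrightarrow> vge 0 x"
  by (simp add: in_O_def vge_def)

lemma in_P_vge: "in_P val x \<longleftrightarrow> vge 1 x"
  by (simp add: in_P_def vge_def)

lemma val_mult: "x \<noteq> 0 \<Longrightarrow> y \<noteq> 0 \<Longrightarrow> val (x * y) = val x + val y"
  using dv by (simp add: discrete_valuation_def)

lemma val_one [simp]: "val 1 = 0"
  using val_mult[of 1 1] by simp

lemma val_uminus [simp]: "val (- x) = val x"
proof (cases "x = 0")
  case False
  have "val (- 1) = 0"
    using val_mult[of "- 1" "- 1"] by simp
  then show ?thesis
    using val_mult[of "- 1" x] False by simp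
qed simp

lemma val_inverse: "x \<noteq> 0 \<Longrightarrow> val (inverse x) = - val x"
  using val_mult[of x "inverse x"] by simp

lemma val_divide: "x \<noteq> 0 \<Longrightarrow> y \<noteq> 0 \<Longrightarrow> val (x / y) = val x - val y"
  by (simp add: divide_inverse val_mult val_inverse)

lemma vge_zero [simp]: "vge n 0"
  by (simp add: vge_def)

lemma vge_one [simp]: "vge 0 1"
  by (simp add: vge_def)

lemma vge_mono: "vge n x \<Longrightarrow> m \<le> n \<Longrightarrow> vge m x"
  by (auto simp: vge_def)

lemma vge_add: "vge n x \<Longrightarrow> vge n y \<Longrightarrow> vge n (x + y)"
proof (cases "x = 0 \<or> y = 0 \<or> x + y = 0")
  case False
  then have "val (x + y) \<ge> min (val x) (val y)"
    using dv by (simp add: discrete_valuation_def)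
  then show "vge n x \<Longrightarrow> vge n y \<Longrightarrow> vge n (x + y)"
    using False by (auto simp: vge_def)
qed auto

lemma vge_uminus [simp]: "vge n (- x) \<longleftrightarrow> vge n x"
  by (simp add: vge_def)

lemma vge_diff: "vge n x \<Longrightarrow> vge n y \<Longrightarrow> vge n (x - y)"
  using vge_add[of n x "- y"] by simp

lemma vge_mult: "vge m x \<Longrightarrow> vge n y \<Longrightarrow> vge (m + n) (x * y)"
  by (cases "x = 0"; cases "y = 0") (auto simp: vge_def val_mult)

lemma vge_mult0: "vge 0 x \<Longrightarrow> vge n y \<Longrightarrow> vge n (x * y)"
  using vge_mult[of 0 x n y] by simp

text \<open>The negated premise encodes at once that \<open>y\<close> is nonzero and that
  \<open>val y \<le> n\<close>; later it is how a pivot is recognised.\<close>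

lemma vge_divide: "vge m x \<Longrightarrow> \<not> vge (n + 1) y \<Longrightarrow> vge (m - n) (x / y)"
  by (cases "x = 0") (auto simp: vge_def val_divide)

lemma vge_unif [simp]: "vge n unif \<longleftrightarrow> n \<le> 1"
  using unif by (simp add: vge_def)

lemma val_unif_powi: "val (unif powi k) = k"
proof -
  have nat: "val (unif ^ n) = int n" for n
    by (induction n) (use unif in \<open>simp_all add: val_mult\<close>)
  show ?thesis
    using unif by (cases "0 \<le> k") (simp_all add: power_int_def nat val_inverse power_inverse)
qed

section \<open>Lattices and their covolume\<close>

definition lat :: "'a \<times> 'a \<Rightarrow> 'a \<times> 'a \<Rightarrow> ('a \<times> 'a) set" where
  "lat e f = {vadd (smul a e) (smul b f) | a b. vge 0 a \<and> vge 0 b}"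

lemma lattice_iff: "lattice val L \<longleftrightarrow> (\<exists>e f. det2 e f \<noteq> 0 \<and> L = lat e f)"
  by (simp add: lattice_def lat_def det2_def in_O_vge)

lemma lattice_lat: "det2 e f \<noteq> 0 \<Longrightarrow> lattice val (lat e f)"
  using lattice_iff by blast

definition submod :: "('a \<times> 'a) set \<Rightarrow> bool" where
  "submod M \<longleftrightarrow> (\<forall>u\<in>M. \<forall>w\<in>M. vadd u w \<in> M) \<and> (\<forall>a. \<forall>u\<in>M. vge 0 a \<longrightarrow> smul a u \<in> M)"

lemma submodD:
  assumes "submod M"
  shows "u \<in> M \<Longrightarrow> w \<in> M \<Longrightarrow> vadd u w \<in> M" "u \<in> M \<Longrightarrow> vge 0 a \<Longrightarrow> smul a u \<in> M"
  using assms by (auto simp: submod_def)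

lemma submod_lat: "submod (lat e f)"
  unfolding submod_def
proof safe
  fix u1 u2 w1 w2
  assume "(u1, u2) \<in> lat e f" "(w1, w2) \<in> lat e f"
  then obtain a b c d where "(u1, u2) = vadd (smul a e) (smul b f)" "(w1, w2) = vadd (smul c e) (smul d f)"
    and v: "vge 0 a" "vge 0 b" "vge 0 c" "vge 0 d"
    by (auto simp: lat_def)
  then have "vadd (u1, u2) (w1, w2) = vadd (smul (a + c) e) (smul (b + d) f)"
    by (simp add: prod_eq_iff algebra_simps)
  then show "vadd (u1, u2) (w1, w2) \<in> lat e f"
    unfolding lat_def using v vge_add by blast
next
  fix r u1 u2
  assume "(u1, u2) \<in> lat e f" and r: "vge 0 r"
  then obtain a b where "(u1, u2) = vadd (smul a e) (smul b f)" and v: "vge 0 a" "vge 0 b"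
    by (auto simp: lat_def)
  then have "smul r (u1, u2) = vadd (smul (r * a) e) (smul (r * b) f)"
    by (simp add: smul_vadd smul_smul)
  then show "smul r (u1, u2) \<in> lat e f"
    unfolding lat_def using v r vge_mult0 by blast
qed

lemma submod_lattice: "lattice val L \<Longrightarrow> submod L"
  by (auto simp: lattice_iff submod_lat)

lemma lat_gens [simp]: "e \<in> lat e f" "f \<in> lat e f"
proof -
  have "e = vadd (smul 1 e) (smul 0 f)" "f = vadd (smul 0 e) (smul 1 f)"
    by (simp_all add: prod_eq_iff)
  then show "e \<in> lat e f" "f \<in> lat e f"
    unfolding lat_def using vge_one vge_zero by blast+
qed

lemma lat_subset_iff:
  assumes "submod M"
  shows "lat e f \<subseteq> M \<longleftrightarrow> e \<in> M \<and> f \<in> M"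
proof
  assume "e \<in> M \<and> f \<in> M"
  then show "lat e f \<subseteq> M"
    using assms by (auto simp: lat_def intro!: submodD)
qed (use lat_gens[of e f] in auto)

lemma lat_commute: "lat e f = lat f e"
  by (simp add: set_eq_subset lat_subset_iff submod_lat)

lemma det2_commute: "det2 e f = - det2 f e"
  by (simp add: det2_def)

text \<open>The inclusion gives an integral transition matrix, whose determinant \<open>u\<close> is
  integral. Equal valuations make \<open>u\<close> a unit, and then Cramer's rule inverts the matrix
  over the integers.\<close>

lemma lat_subset_det:
  assumes "lat f1 f2 \<subseteq> lat e1 e2" "det2 e1 e2 \<noteq> 0" "det2 f1 f2 \<noteq> 0"
  shows "val (det2 e1 e2) \<le> val (det2 f1 f2)"
    and "val (det2 e1 e2) = val (det2 f1 f2) \<Longrightarrow> lat f1 f2 = lat e1 e2"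
proof -
  have "f1 \<in> lat e1 e2" "f2 \<in> lat e1 e2"
    using assms(1) by (simp_all add: lat_subset_iff submod_lat)
  then obtain a b c d where f: "f1 = vadd (smul a e1) (smul b e2)" "f2 = vadd (smul c e1) (smul d e2)"
    and v: "vge 0 a" "vge 0 b" "vge 0 c" "vge 0 d"
    by (auto simp: lat_def)
  define u where "u = a * d - b * c"
  have det: "det2 f1 f2 = u * det2 e1 e2"
    by (simp add: f det2_comb u_def)
  then have u0: "u \<noteq> 0"
    using assms(3) by auto
  have valdet: "val (det2 f1 f2) = val u + val (det2 e1 e2)"
    using det u0 assms(2) by (simp add: val_mult)
  have "vge 0 u"
    unfolding u_def using v by (intro vge_diff vge_mult0)
  then show "val (det2 e1 e2) \<le> val (det2 f1 f2)"
    using u0 valdet by (simp add: vge_def)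
  assume "val (det2 e1 e2) = val (det2 f1 f2)"
  then have "\<not> vge (0 + 1) u"
    using valdet u0 by (simp add: vge_def)
  then have v': "vge 0 (d / u)" "vge 0 (- b / u)" "vge 0 (- c / u)" "vge 0 (a / u)"
    using vge_divide[of 0 d 0 u] vge_divide[of 0 "- b" 0 u] vge_divide[of 0 "- c" 0 u]
      vge_divide[of 0 a 0 u] v by simp_all
  have "e1 = vadd (smul (d / u) f1) (smul (- b / u) f2)" "e2 = vadd (smul (- c / u) f1) (smul (a / u) f2)"
    using det2_comb_inverse[OF _ f] u0 by (simp_all add: u_def)
  then have "e1 \<in> lat f1 f2" "e2 \<in> lat f1 f2"
    unfolding lat_def using v' by blast+
  then show "lat f1 f2 = lat e1 e2"
    using assms(1) by (simp add: set_eq_subset lat_subset_iff submod_lat)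
qed

text \<open>Independent of the basis, since two bases of one lattice give inclusions both ways in
  \<open>lat_subset_det\<close>.\<close>

definition covol :: "('a \<times> 'a) set \<Rightarrow> int" where
  "covol L = (THE n. \<exists>e f. det2 e f \<noteq> 0 \<and> L = lat e f \<and> n = val (det2 e f))"

lemma covol_lat: "det2 e f \<noteq> 0 \<Longrightarrow> covol (lat e f) = val (det2 e f)"
  unfolding covol_def
proof (rule the_equality)
  assume "det2 e f \<noteq> 0"
  fix n assume "\<exists>e' f'. det2 e' f' \<noteq> 0 \<and> lat e f = lat e' f' \<and> n = val (det2 e' f')"
  then obtain e' f' where "det2 e' f' \<noteq> 0" "lat e f = lat e' f'" "n = val (det2 e' f')"
    by blast
  then show "n = val (det2 e f)"
    using lat_subset_det(1)[of e f e' f'] lat_subset_det(1)[of e' f' e f] \<open>det2 e f \<noteq> 0\<close> by simp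
qed blast

lemma lattice_subset_covol:
  assumes "lattice val L" "lattice val M" "L \<subseteq> M"
  shows "covol M \<le> covol L" and "covol M = covol L \<Longrightarrow> L = M"
proof -
  obtain e f e' f' where L: "L = lat e f" "det2 e f \<noteq> 0" and M: "M = lat e' f'" "det2 e' f' \<noteq> 0"
    using assms lattice_iff by auto
  show "covol M \<le> covol L" "covol M = covol L \<Longrightarrow> L = M"
    using lat_subset_det[of e f e' f'] assms(3) L M by (simp_all add: covol_lat)
qed

section \<open>Depth and level relative to the standard lattice\<close>

definition ball :: "int \<Rightarrow> ('a \<times> 'a) set" where
  "ball n = {u. vge n (fst u) \<and> vge n (snd u)}"

lemma submod_ball: "submod (ball n)"
  by (auto simp: submod_def ball_def intro: vge_add vge_mult0)

lemma ball_antimono: "m \<le> n \<Longrightarrow> ball n \<subseteq> ball m"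
  by (auto simp: ball_def intro: vge_mono)

lemma vge_divide_unif: "vge n x \<Longrightarrow> vge 0 (x / unif powi n)"
  using unif by (cases "x = 0") (auto simp: vge_def val_divide val_unif_powi)

lemma ball_eq_lat: "ball n = lat (unif powi n, 0) (0, unif powi n)"
proof
  show "lat (unif powi n, 0) (0, unif powi n) \<subseteq> ball n"
    by (simp add: lat_subset_iff submod_ball) (simp add: ball_def vge_def val_unif_powi)
  show "ball n \<subseteq> lat (unif powi n, 0) (0, unif powi n)"
  proof
    fix u assume "u \<in> ball n"
    then have "vge 0 (fst u / unif powi n)" "vge 0 (snd u / unif powi n)"
      using vge_divide_unif by (simp_all add: ball_def)
    moreover have "u = vadd (smul (fst u / unif powi n) (unif powi n, 0)) (smul (snd u / unif powi n) (0, unif powi n))"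
      using unif by (simp add: prod_eq_iff)
    ultimately show "u \<in> lat (unif powi n, 0) (0, unif powi n)"
      unfolding lat_def by blast
  qed
qed

lemma
  shows lattice_ball: "lattice val (ball n)" and covol_ball: "covol (ball n) = 2 * n"
proof -
  have "det2 (unif powi n, 0) (0, unif powi n) = unif powi n * unif powi n"
    by (simp add: det2_def)
  then show "lattice val (ball n)" "covol (ball n) = 2 * n"
    using unif by (simp_all add: ball_eq_lat lattice_lat covol_lat val_mult val_unif_powi)
qed

definition crit :: "('a \<times> 'a) set \<Rightarrow> int \<Rightarrow> bool" where
  "crit L n \<longleftrightarrow> L \<subseteq> ball n \<and> \<not> L \<subseteq> ball (n + 1)"

lemma crit_unique: "crit L m \<Longrightarrow> crit L n \<Longrightarrow> m = n"
proof (induction m n rule: linorder_wlog)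
  case (le m n)
  show ?case
  proof (rule ccontr)
    assume "m \<noteq> n"
    then have "ball n \<subseteq> ball (m + 1)"
      using le(1) by (intro ball_antimono) simp
    then show False
      using le by (auto simp: crit_def)
  qed
qed simp

lemma crit_exists:
  assumes "lattice val L"
  shows "\<exists>n. crit L n"
proof -
  obtain e f where L: "L = lat e f" "det2 e f \<noteq> 0"
    using assms lattice_iff by auto
  \<comment> \<open>A zero coordinate contributes a meaningless value of \<open>val\<close>, which
    is harmless: only a lower bound is needed and \<open>vge\<close> always accepts 0.\<close>
  define n0 where "n0 = min (min (val (fst e)) (val (snd e))) (min (val (fst f)) (val (snd f)))"
  have sub: "L \<subseteq> ball n0"
    by (simp add: L lat_subset_iff submod_ball) (auto simp: ball_def vge_def n0_def)
  have not_sub: "\<exists>j. \<not> L \<subseteq> ball (n0 + int j)"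
  proof (rule ccontr)
    assume "\<not> ?thesis"
    \<comment> \<open>This radius is so large that its double exceeds \<open>covol L\<close>, given
      \<open>2 * n0 \<le> covol L\<close>, whereas a ball containing \<open>L\<close> cannot have
      larger covolume than \<open>L\<close>.\<close>
    then have "L \<subseteq> ball (n0 + int (nat (covol L - 2 * n0 + 1)))"  (is "L \<subseteq> ball ?n")
      by blast
    then have "2 * ?n \<le> covol L" "2 * n0 \<le> covol L"
      using lattice_subset_covol(1)[OF assms lattice_ball] covol_ball sub by metis+
    then show False
      by simp
  qed
  define j where "j = (LEAST j. \<not> L \<subseteq> ball (n0 + int j))"
  have j: "\<not> L \<subseteq> ball (n0 + int j)" and j': "\<And>i. i < j \<Longrightarrow> L \<subseteq> ball (n0 + int i)"
    unfolding j_def using LeastI_ex[OF not_sub] not_less_Least by blast+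
  have "j \<noteq> 0"
    using sub j by (metis add.right_neutral of_nat_0)
  then have "crit L (n0 + int (j - 1))"
    using j j'[of "j - 1"] by (simp add: crit_def of_nat_diff)
  then show ?thesis ..
qed

definition depth :: "('a \<times> 'a) set \<Rightarrow> int" where
  "depth L = (THE n. crit L n)"

lemma crit_iff_depth: "lattice val L \<Longrightarrow> crit L n \<longleftrightarrow> depth L = n"
  unfolding depth_def using crit_unique crit_exists by (metis the_equality)

lemma subset_ball_iff: "lattice val L \<Longrightarrow> L \<subseteq> ball n \<longleftrightarrow> n \<le> depth L"
proof -
  assume "lattice val L"
  then have "L \<subseteq> ball (depth L)" "\<not> L \<subseteq> ball (depth L + 1)"
    using crit_iff_depth by (auto simp: crit_def)
  then show ?thesis
    using ball_antimono[of n "depth L"] ball_antimono[of "depth L + 1" n] by force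
qed

lemma depth_covol: "lattice val L \<Longrightarrow> 2 * depth L \<le> covol L"
  using lattice_subset_covol(1)[OF _ lattice_ball, of L "depth L"] by (simp add: subset_ball_iff covol_ball)

text \<open>A natural number, so that it can carry inductions and ranks; by
  \<open>depth_covol\<close> the truncation loses nothing on lattices.\<close>

definition lev :: "('a \<times> 'a) set \<Rightarrow> nat" where
  "lev L = nat (covol L - 2 * depth L)"

lemma lev: "lattice val L \<Longrightarrow> int (lev L) = covol L - 2 * depth L"
  using depth_covol by (simp add: lev_def)

section \<open>Scaling by powers of the uniformizer\<close>

definition scale :: "int \<Rightarrow> ('a \<times> 'a) set \<Rightarrow> ('a \<times> 'a) set" where
  "scale k L = smul (unif powi k) ` L"

lemma scale_0 [simp]: "scale 0 L = L"
  by (simp add: scale_def)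

lemma scale_scale [simp]: "scale k (scale l L) = scale (k + l) L"
  using unif by (simp add: scale_def image_image smul_smul power_int_add)

lemma scale_mono: "L \<subseteq> M \<Longrightarrow> scale k L \<subseteq> scale k M"
  by (auto simp: scale_def)

lemma scale_subset_iff: "scale k L \<subseteq> M \<longleftrightarrow> L \<subseteq> scale (- k) M"
  using scale_mono[of "scale k L" M "- k"] scale_mono[of L "scale (- k) M" k] by auto

lemma scale_eq_iff: "scale k L = M \<longleftrightarrow> L = scale (- k) M"
  by auto

lemma scale_lat: "scale k (lat e f) = lat (smul (unif powi k) e) (smul (unif powi k) f)"
proof -
  have "smul c (vadd (smul a e) (smul b f)) = vadd (smul a (smul c e)) (smul b (smul c f))" for a b c
    by (simp add: prod_eq_iff algebra_simps)
  moreover have "smul c ` lat e f = {smul c (vadd (smul a e) (smul b f)) | a b. vge 0 a \<and> vge 0 b}" for c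
    unfolding lat_def by blast
  ultimately have "smul c ` lat e f = lat (smul c e) (smul c f)" for c
    unfolding lat_def by presburger
  then show ?thesis
    by (simp add: scale_def)
qed

lemma scale_ball: "scale k (ball n) = ball (n + k)"
  using unif by (simp add: ball_eq_lat scale_lat smul_def power_int_add mult.commute)

lemma
  assumes "lattice val L"
  shows lattice_scale: "lattice val (scale k L)"
    and covol_scale: "covol (scale k L) = covol L + 2 * k"
    and depth_scale: "depth (scale k L) = depth L + k"
    and lev_scale: "lev (scale k L) = lev L"
proof -
  obtain e f where L: "L = lat e f" "det2 e f \<noteq> 0"
    using assms lattice_iff by auto
  then have det: "det2 (smul (unif powi k) e) (smul (unif powi k) f) = unif powi k * (unif powi k * det2 e f)"
    by (simp add: det2_smul)
  with L unif show lattice: "lattice val (scale k L)"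
    by (simp add: scale_lat lattice_lat)
  show covol: "covol (scale k L) = covol L + 2 * k"
    using L det unif by (simp add: scale_lat covol_lat val_mult val_unif_powi)
  \<comment> \<open>The depth is determined by the set of all balls containing the lattice, and
    scaling shifts that set by \<open>k\<close>.\<close>
  have "scale k L \<subseteq> ball n \<longleftrightarrow> L \<subseteq> ball (n - k)" for n
    by (simp add: scale_subset_iff scale_ball)
  then have "n \<le> depth (scale k L) \<longleftrightarrow> n \<le> depth L + k" for n
    using assms lattice by (simp add: subset_ball_iff algebra_simps)
  then show depth: "depth (scale k L) = depth L + k"
    by (meson order_antisym order_refl)
  show "lev (scale k L) = lev L"
    by (simp add: lev_def covol depth)
qed

section \<open>Adapted bases of sublattices of index q\<close>

text \<open>An elementary operation on the basis, used to clear an entry of \<open>e\<close> with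
  the pivot \<open>f\<close>.\<close>

lemma lat_adapt:
  assumes "vge 0 c"
  shows "lat (vadd e (smul c f)) f = lat e f"
proof -
  have "e = vadd (vadd e (smul c f)) (smul (- c) f)"
    by (simp add: prod_eq_iff)
  then have "e \<in> lat (vadd e (smul c f)) f"
    using assms by (metis lat_gens submodD submod_lat vge_uminus)
  moreover have "vadd e (smul c f) \<in> lat e f"
    using assms by (metis lat_gens submodD submod_lat)
  ultimately show ?thesis
    by (simp add: set_eq_subset lat_subset_iff submod_lat)
qed

lemma det2_adapt: "det2 (vadd e (smul c f)) f = det2 e f"
  by (simp add: det2_def algebra_simps)

lemma in_lat_unif_iff:
  assumes "det2 e f \<noteq> 0" "vge 0 a"
  shows "vadd (smul a e) (smul b f) \<in> lat e (smul unif f) \<longleftrightarrow> vge 1 b"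
proof
  assume "vadd (smul a e) (smul b f) \<in> lat e (smul unif f)"
  then obtain a' b' where "vadd (smul a e) (smul b f) = vadd (smul a' e) (smul (b' * unif) f)" "vge 0 b'"
    by (auto simp: lat_def smul_smul)
  then have "b = b' * unif"
    using det2_coords_unique(2)[OF assms(1)] by blast
  then show "vge 1 b"
    using \<open>vge 0 b'\<close> by (simp add: vge_mult0)
next
  assume "vge 1 b"
  then have "vge 0 (b / unif)"
    using vge_divide_unif[of 1 b] by simp
  moreover have "vadd (smul a e) (smul b f) = vadd (smul a e) (smul (b / unif) (smul unif f))"
    using unif by (simp add: smul_smul)
  ultimately show "vadd (smul a e) (smul b f) \<in> lat e (smul unif f)"
    unfolding lat_def using assms(2) by blast
qed

lemma index_p_subI:
  assumes "det2 e f \<noteq> 0"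
  shows "index_p_sub val (lat e (smul unif f)) (lat e f)"
proof -
  \<comment> \<open>By Cramer's rule this is the \<open>f\<close>-coordinate, whose reduction modulo
    the maximal ideal has the required kernel.\<close>
  define h where "h x = det2 e x / det2 e f" for x
  have h: "h (vadd (smul a e) (smul b f)) = b" for a b
  proof -
    have "det2 e (vadd (smul a e) (smul b f)) = b * det2 e f"
      by (simp add: det2_def algebra_simps)
    then show ?thesis
      using assms by (simp add: h_def)
  qed
  have hadd: "h (vadd x y) = h x + h y" and hsmul: "h (smul a x) = a * h x" for a x y
    by (simp_all add: h_def det2_def field_simps add_divide_distrib diff_divide_distrib)
  have "lat e (smul unif f) \<subseteq> lat e f"
    by (simp add: lat_subset_iff submod_lat submodD)
  moreover have "in_O val (h x) \<and> (in_P val (h x) \<longleftrightarrow> x \<in> lat e (smul unif f))" if "x \<in> lat e f" for x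
    using that by (auto simp: lat_def[of e f] h in_O_vge in_P_vge in_lat_unif_iff assms)
  moreover have "\<exists>x\<in>lat e f. in_P val (h x - a)" if "in_O val a" for a
  proof
    have "h (smul a f) = a"
      using h[of 0 a] by (simp add: vadd_def smul_def)
    then show "in_P val (h (smul a f) - a)"
      by (simp add: in_P_vge)
    show "smul a f \<in> lat e f"
      using that by (simp add: submodD submod_lat in_O_vge)
  qed
  ultimately show ?thesis
    unfolding index_p_sub_def using assms unif
    by (intro conjI exI[of _ h]) (auto simp: lattice_lat det2_smul hadd hsmul in_P_vge)
qed

lemma index_p_sub_lattice: "index_p_sub val w v \<Longrightarrow> lattice val w"
  by (simp add: index_p_sub_def)

text \<open>This replaces the abstract quotient map by an adapted basis. Some basis vector
  \<open>f\<close> has a unit value under \<open>h\<close>; subtracting a multiple of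
  \<open>f\<close> moves the other into the kernel, and then only the \<open>f\<close>-coordinate
  decides membership in \<open>w\<close>.\<close>

lemma index_p_subE:
  assumes "index_p_sub val w v" "lattice val v"
  obtains e f where "det2 e f \<noteq> 0" "v = lat e f" "w = lat e (smul unif f)"
proof -
  obtain h where w: "submod w" "w \<subseteq> v"
    and hO: "\<And>x. x \<in> v \<Longrightarrow> vge 0 (h x)"
    and hadd: "\<And>x y. x \<in> v \<Longrightarrow> y \<in> v \<Longrightarrow> vge 1 (h (vadd x y) - h x - h y)"
    and hsmul: "\<And>a x. vge 0 a \<Longrightarrow> x \<in> v \<Longrightarrow> vge 1 (h (smul a x) - a * h x)"
    and hker: "\<And>x. x \<in> v \<Longrightarrow> vge 1 (h x) \<longleftrightarrow> x \<in> w"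
    and hsurj: "\<And>a. vge 0 a \<Longrightarrow> \<exists>x\<in>v. vge 1 (h x - a)"
    using assms(1) unfolding index_p_sub_def in_O_vge in_P_vge using submod_lattice by blast
  have v: "submod v"
    using assms(2) by (rule submod_lattice)
  have hlin: "vge 1 (h (vadd (smul a x) (smul b y)) - (a * h x + b * h y))"
    if "vge 0 a" "vge 0 b" "x \<in> v" "y \<in> v" for a b x y
  proof -
    have "vge 1 ((h (vadd (smul a x) (smul b y)) - h (smul a x) - h (smul b y))
        + (h (smul a x) - a * h x) + (h (smul b y) - b * h y))"
      using that v by (intro vge_add hadd hsmul submodD)
    then show ?thesis
      by (simp add: algebra_simps)
  qed
  have main: "\<exists>e f. det2 e f \<noteq> 0 \<and> v = lat e f \<and> w = lat e (smul unif f)"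
    if e0: "det2 e0 f \<noteq> 0" "v = lat e0 f" and f: "\<not> vge 1 (h f)" for e0 f
  proof -
    \<comment> \<open>Chosen so that \<open>h e0 + c * h f = 0\<close>; it is integral because
      \<open>h f\<close> is a unit.\<close>
    define c where "c = - (h e0 / h f)"
    define e where "e = vadd e0 (smul c f)"
    have fv: "e0 \<in> v" "f \<in> v"
      using e0 by auto
    have "h f \<noteq> 0"
      using f by auto
    have c: "vge 0 c"
      using vge_divide[of 0 "h e0" 0 "h f"] hO fv f by (simp add: c_def)
    then have ef: "det2 e f \<noteq> 0" "v = lat e f"
      using e0 by (simp_all add: e_def det2_adapt lat_adapt)
    have "vge 1 (h (vadd (smul 1 e0) (smul c f)) - (1 * h e0 + c * h f))"
      using fv c by (intro hlin) auto
    then have he: "vge 1 (h e)"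
      using \<open>h f \<noteq> 0\<close> by (simp add: e_def c_def)
    have ev: "e \<in> v"
      using ef by simp
    have "x \<in> w \<longleftrightarrow> x \<in> lat e (smul unif f)" if "x \<in> v" for x
    proof -
      obtain a b where x: "x = vadd (smul a e) (smul b f)" "vge 0 a" "vge 0 b"
        using \<open>x \<in> v\<close> ef by (auto simp: lat_def)
      have 1: "vge 1 (h x - b * h f)"
        using vge_add[OF hlin[OF x(2,3) ev fv(2)] vge_mult0[OF x(2) he]] x(1) by (simp add: algebra_simps)
      have "x \<in> w \<longleftrightarrow> vge 1 (h x)"
        using hker that by simp
      also have "\<dots> \<longleftrightarrow> vge 1 (b * h f)"
        using 1 vge_add[of 1 "h x - b * h f" "b * h f"] vge_diff[of 1 "h x" "h x - b * h f"] by auto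
      also have "\<dots> \<longleftrightarrow> vge 1 b"
        using f hO[OF fv(2)] \<open>h f \<noteq> 0\<close> vge_divide[of 1 "b * h f" 0 "h f"] vge_mult0[of "h f" 1 b]
        by (auto simp: mult.commute)
      also have "\<dots> \<longleftrightarrow> x \<in> lat e (smul unif f)"
        using in_lat_unif_iff[OF ef(1) x(2)] x(1) by simp
      finally show ?thesis .
    qed
    moreover have "lat e (smul unif f) \<subseteq> v"
      by (simp add: ef lat_subset_iff submod_lat submodD)
    ultimately have "w = lat e (smul unif f)"
      using w by blast
    then show ?thesis
      using ef by blast
  qed
  obtain e f where ef: "det2 e f \<noteq> 0" "v = lat e f"
    using assms(2) lattice_iff by auto
  \<comment> \<open>If both basis vectors were in the kernel, \<open>h\<close> would vanish modulo
    the maximal ideal on all of \<open>v\<close> and could not reach 1.\<close>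
  have "\<not> vge 1 (h e) \<or> \<not> vge 1 (h f)"
  proof (rule ccontr)
    assume "\<not> ?thesis"
    then have "e \<in> w" "f \<in> w"
      using hker ef by auto
    then have "v \<subseteq> w"
      using w ef by (simp add: lat_subset_iff)
    moreover obtain x where x: "x \<in> v" "vge 1 (h x - 1)"
      using hsurj[of 1] by auto
    ultimately have "vge 1 (h x)"
      using hker by blast
    then have "vge 1 (h x - (h x - 1))"
      using x vge_diff by blast
    then show False
      by (simp add: vge_def)
  qed
  then show ?thesis
    using main[of e f] main[of f e] ef that lat_commute[of e f] det2_commute[of e f] by auto
qed

text \<open>This sandwich bounds the change of depth and yields the finiteness of neighbours in both
  directions.\<close>

lemma index_p_sub_scale_subset: "index_p_sub val w v \<Longrightarrow> lattice val v \<Longrightarrow> w \<subseteq> v \<and> scale 1 v \<subseteq> w"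
proof (elim index_p_subE)
  fix e f assume "v = lat e f" "w = lat e (smul unif f)"
  then show "w \<subseteq> v \<and> scale 1 v \<subseteq> w"
    by (simp add: scale_lat lat_subset_iff submod_lat submodD)
qed

lemma index_p_sub_scale:
  assumes "lattice val v" "index_p_sub val w v"
  shows "index_p_sub val (scale k w) (scale k v)"
proof -
  obtain e f where ef: "det2 e f \<noteq> 0" "v = lat e f" "w = lat e (smul unif f)"
    using assms index_p_subE by blast
  let ?e = "smul (unif powi k) e" and ?f = "smul (unif powi k) f"
  have "index_p_sub val (lat ?e (smul unif ?f)) (lat ?e ?f)"
    using ef unif by (intro index_p_subI) (simp add: det2_smul)
  then show ?thesis
    using ef by (simp add: scale_lat smul_smul mult.commute)
qed

lemma index_p_sub_covol:
  assumes "index_p_sub val w v" "lattice val v"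
  shows "covol w = covol v + 1"
  using assms
proof (elim index_p_subE)
  fix e f assume "det2 e f \<noteq> 0" "v = lat e f" "w = lat e (smul unif f)"
  then show ?thesis
    using unif by (simp add: covol_lat det2_smul val_mult)
qed

lemma index_p_sub_depth:
  assumes "index_p_sub val w v" "lattice val v"
  shows "depth w = depth v \<or> depth w = depth v + 1"
proof -
  have w: "lattice val w"
    using assms index_p_sub_lattice by blast
  have "w \<subseteq> ball (depth v)" "scale 1 v \<subseteq> ball (depth w)"
    using index_p_sub_scale_subset[OF assms] subset_ball_iff assms(2) w by blast+
  then show ?thesis
    using assms w by (auto simp: subset_ball_iff lattice_scale depth_scale)
qed

text \<open>The covolume grows by 1 while twice the depth grows by 0 or 2, so the level moves by
  exactly one.\<close>

lemma index_p_sub_lev: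
  assumes "index_p_sub val w v" "lattice val v"
  shows "depth w = depth v \<Longrightarrow> lev w = lev v + 1" "depth w = depth v + 1 \<Longrightarrow> lev v = lev w + 1"
  using lev[of v] lev[of w] index_p_sub_covol[OF assms] index_p_sub_lattice[OF assms(1)] assms(2)
  by linarith+

lemma index_p_sub_lev_cases:
  assumes "index_p_sub val w v" "lattice val v"
  shows "lev w = lev v + 1 \<or> lev v = lev w + 1"
  using index_p_sub_depth[OF assms] index_p_sub_lev[OF assms] by blast

section \<open>Parents and children in the tree\<close>

text \<open>\<open>w\<close> is the neighbour of \<open>v\<close> nearer to the standard vertex, and
  as a lattice it is the smaller of the two. So \<open>T\<close>, which sums over sublattices,
  passes values from a parent to its children.\<close>

definition parent :: "('a \<times> 'a) set \<Rightarrow> ('a \<times> 'a) set \<Rightarrow> bool" where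
  "parent w v \<longleftrightarrow> lattice val v \<and> index_p_sub val w v \<and> lev v = lev w + 1"

lemma parent_depth: "parent w v \<Longrightarrow> depth w = depth v + 1"
  using index_p_sub_depth[of w v] index_p_sub_lev(1)[of w v] by (auto simp: parent_def)

text \<open>A parent of \<open>v\<close> is contained in the proper submodule \<open>v \<inter> ball (depth v + 1)\<close>
  of \<open>v\<close> and, being maximal, is equal to it.\<close>
lemma parent_unique:
  assumes "parent w v" "parent w' v"
  shows "w = w'"
proof -
  have v: "lattice val v" "index_p_sub val w v" "index_p_sub val w' v"
    using assms by (auto simp: parent_def)
  have lat: "lattice val w" "lattice val w'"
    using v index_p_sub_lattice by blast+
  have depth: "depth w = depth v + 1" "depth w' = depth v + 1"
    using assms parent_depth by blast+
  have "w' \<subseteq> w"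
  proof
    fix x assume x: "x \<in> w'"
    obtain e f where ef: "det2 e f \<noteq> 0" "v = lat e f" "w = lat e (smul unif f)"
      using v index_p_subE by blast
    have "x \<in> v"
      using x index_p_sub_scale_subset v by blast
    then obtain a b where ab: "x = vadd (smul a e) (smul b f)" "vge 0 a" "vge 0 b"
      using ef by (auto simp: lat_def)
    have "w \<subseteq> ball (depth v + 1)" "w' \<subseteq> ball (depth v + 1)"
      using depth lat by (simp_all add: subset_ball_iff)
    then have e: "e \<in> ball (depth v + 1)" and xb: "x \<in> ball (depth v + 1)"
      using ef x by auto
    \<comment> \<open>If \<open>b\<close> were a unit, \<open>f\<close> would be a combination of
      \<open>x\<close> and \<open>e\<close> and would lie in the smaller ball together with all of
      \<open>v\<close>.\<close>
    have "vge 1 b"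
    proof (rule ccontr)
      assume b: "\<not> vge 1 b"
      then have "b \<noteq> 0" "vge 0 (- (a / b))" "vge 0 (1 / b)"
        using vge_divide[of 0 _ 0 b] ab(2) by auto
      moreover have "f = vadd (smul (1 / b) x) (smul (- (a / b)) e)"
        using \<open>b \<noteq> 0\<close> by (simp add: prod_eq_iff ab(1) field_simps)
      ultimately have "f \<in> ball (depth v + 1)"
        using e xb submod_ball by (metis submodD)
      then have "v \<subseteq> ball (depth v + 1)"
        using e ef by (simp add: lat_subset_iff submod_ball)
      then show False
        using v by (simp add: subset_ball_iff)
    qed
    then show "x \<in> w"
      using ab ef in_lat_unif_iff by simp
  qed
  moreover have "covol w = covol w'"
    using v by (simp add: index_p_sub_covol)
  ultimately show ?thesis
    using lattice_subset_covol(2)[OF lat(2,1)] by simp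
qed

lemma parentI:
  assumes "lattice val v" "index_p_sub val w v" "w \<subseteq> ball (depth v + 1)"
  shows "parent w v"
proof -
  have "depth v + 1 \<le> depth w"
    using assms index_p_sub_lattice subset_ball_iff by blast
  then show ?thesis
    using index_p_sub_depth[OF assms(2,1)] index_p_sub_lev(2)[OF assms(2,1)] assms
    by (auto simp: parent_def)
qed

text \<open>A basis vector \<open>f\<close> with a coordinate of minimal valuation serves as pivot
  and clears that coordinate of the other vector \<open>e\<close>. Positive level forces the
  remaining coordinate of \<open>e\<close> into the next ball, so \<open>e\<close> and
  \<open>unif\<close> times \<open>f\<close> span the parent.\<close>

lemma parent_exists:
  assumes v: "lattice val v" and pos: "0 < lev v"
  shows "\<exists>w. parent w v"
proof -
  \<comment> \<open>\<open>proj\<close> is the coordinate in which \<open>f\<close> attains the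
    depth and \<open>proj'\<close> the other one, so one argument covers both coordinates.\<close>
  have main: "\<exists>w. parent w v"
    if ef: "det2 e0 f \<noteq> 0" "v = lat e0 f"
      and f: "\<not> vge (depth v + 1) (proj f)" and proj: "proj = fst \<and> proj' = snd \<or> proj = snd \<and> proj' = fst"
    for e0 f and proj proj' :: "'a \<times> 'a \<Rightarrow> 'a"
  proof -
    let ?n = "depth v"
    have fv: "e0 \<in> ball ?n" "f \<in> ball ?n"
      using subset_ball_iff[OF v, of ?n] ef by (auto simp: lat_subset_iff submod_ball)
    have projf: "proj f \<noteq> 0" "val (proj f) = ?n"
      using fv f proj by (auto simp: ball_def vge_def)
    define c where "c = - (proj e0 / proj f)"
    define e where "e = vadd e0 (smul c f)"
    have "vge ?n (proj e0)"
      using fv proj by (auto simp: ball_def)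
    then have "vge 0 c"
      using vge_divide[of ?n "proj e0" ?n "proj f"] f by (simp add: c_def)
    then have ef': "det2 e f \<noteq> 0" "v = lat e f"
      using ef by (simp_all add: e_def det2_adapt lat_adapt)
    have proje: "proj e = 0"
      using proj projf by (auto simp: e_def c_def)
    have "det2 e f = proj f * proj' e \<or> det2 e f = - (proj f * proj' e)"
      using proj proje by (auto simp: det2_def)
    then have "covol v = val (proj f * proj' e)" "proj' e \<noteq> 0"
      using ef' by (auto simp: covol_lat)
    \<comment> \<open>The two factors have valuations summing to \<open>covol v\<close>, which
      exceeds \<open>2 * ?n\<close>, and the first factor contributes exactly
      \<open>?n\<close>.\<close>
    then have "vge (?n + 1) (proj' e)"
      using projf pos lev[OF v] by (auto simp: val_mult vge_def)
    then have "e \<in> ball (?n + 1)"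
      using proje proj by (auto simp: ball_def)
    moreover have "smul unif f \<in> ball (?n + 1)"
      using fv vge_mult[of 1 unif ?n] by (simp add: ball_def add.commute)
    ultimately show ?thesis
      using v ef' index_p_subI[OF ef'(1)] parentI[of v "lat e (smul unif f)"]
      by (auto simp: lat_subset_iff submod_ball)
  qed
  obtain e f where ef: "det2 e f \<noteq> 0" "v = lat e f"
    using v lattice_iff by auto
  have "\<not> v \<subseteq> ball (depth v + 1)"
    using v by (simp add: subset_ball_iff)
  then have "e \<notin> ball (depth v + 1) \<or> f \<notin> ball (depth v + 1)"
    using ef by (simp add: lat_subset_iff submod_ball)
  then show ?thesis
    using main[of e f fst snd] main[of e f snd fst] main[of f e fst snd] main[of f e snd fst]
      ef lat_commute[of e f] det2_commute[of e f]
    by (auto simp: ball_def)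
qed

text \<open>Dividing by \<open>unif\<close> a basis vector that attains the depth gives a lattice
  above \<open>w\<close> of smaller depth.\<close>

lemma child_exists:
  assumes w: "lattice val w"
  shows "\<exists>v. parent w v"
proof -
  have main: "\<exists>v. parent w v"
    if ef: "det2 e f \<noteq> 0" "w = lat e f" and f: "f \<notin> ball (depth w + 1)" for e f
  proof -
    define f' where "f' = smul (inverse unif) f"
    have f': "f = smul unif f'"
      using unif by (simp add: f'_def smul_smul)
    have det: "det2 e f' \<noteq> 0"
      using ef unif by (simp add: f'_def det2_smul)
    then have sub: "index_p_sub val w (lat e f')" and lat: "lattice val (lat e f')"
      using index_p_subI[OF det] ef by (simp_all add: f' lattice_lat)
    have "f' \<notin> ball (depth w)"
      using f vge_mult[of 1 unif "depth w"] by (auto simp: f' ball_def add.commute)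
    then have "\<not> lat e f' \<subseteq> ball (depth w)"
      by (simp add: lat_subset_iff submod_ball)
    then have "depth w = depth (lat e f') + 1"
      using index_p_sub_depth[OF sub lat] lat by (auto simp: subset_ball_iff)
    then show ?thesis
      using sub lat index_p_sub_lev(2)[OF sub lat] by (auto simp: parent_def)
  qed
  obtain e f where ef: "det2 e f \<noteq> 0" "w = lat e f"
    using w lattice_iff by auto
  have "\<not> w \<subseteq> ball (depth w + 1)"
    using w by (simp add: subset_ball_iff)
  then have "e \<notin> ball (depth w + 1) \<or> f \<notin> ball (depth w + 1)"
    using ef by (simp add: lat_subset_iff submod_ball)
  then show ?thesis
    using main[of e f] main[of f e] ef lat_commute[of e f] det2_commute[of e f]
    by auto
qed

section \<open>Finiteness of the sets of neighbours\<close>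

text \<open>Such a lattice is a union of cosets of \<open>scale 1 M\<close> in \<open>M\<close>, so
  it is determined by the representatives it contains, taken from a finite set.\<close>

lemma finite_between:
  assumes M: "lattice val M"
  shows "finite {L. lattice val L \<and> scale 1 M \<subseteq> L \<and> L \<subseteq> M}"
proof -
  obtain e f where ef: "M = lat e f"
    using M lattice_iff by auto
  obtain S where S: "finite S" "\<And>s. s \<in> S \<Longrightarrow> vge 0 s" "\<And>x. vge 0 x \<Longrightarrow> \<exists>s\<in>S. vge 1 (x - s)"
    using fin_res by (auto simp: in_O_vge in_P_vge)
  define g where "g L = {(s, t) \<in> S \<times> S. vadd (smul s e) (smul t f) \<in> L}" for L
  have sub: "L \<subseteq> L'"
    if L: "lattice val L" "scale 1 M \<subseteq> L" "L \<subseteq> M" and L': "lattice val L'" "scale 1 M \<subseteq> L'"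
      and g: "g L = g L'" for L L'
  proof
    fix x assume x: "x \<in> L"
    then obtain a b where ab: "x = vadd (smul a e) (smul b f)" "vge 0 a" "vge 0 b"
      using L(3) ef by (auto simp: lat_def)
    obtain s t where st: "s \<in> S" "t \<in> S" "vge 1 (a - s)" "vge 1 (b - t)"
      using S(3) ab by meson
    define y where "y = vadd (smul s e) (smul t f)"
    \<comment> \<open>This is \<open>x - y\<close>, with \<open>unif\<close> factored out to exhibit
      it as an element of \<open>scale 1 M\<close>.\<close>
    define z where "z = smul unif (vadd (smul ((a - s) / unif) e) (smul ((b - t) / unif) f))"
    have z: "z \<in> scale 1 M"
      using vge_divide_unif[OF st(3)] vge_divide_unif[OF st(4)]
      unfolding z_def scale_def ef lat_def by auto
    have xyz: "x = vadd y z" "y = vadd x (smul (- 1) z)"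
      using unif by (simp_all add: prod_eq_iff ab y_def z_def algebra_simps divide_simps)
    have "y \<in> L"
      using submodD[OF submod_lattice[OF L(1)]] x z L(2) xyz(2)
      by (metis subsetD vge_one vge_uminus)
    then have "y \<in> L'"
      using g st by (auto simp: g_def y_def)
    then show "x \<in> L'"
      using submodD(1)[OF submod_lattice[OF L'(1)]] z L'(2) xyz(1) by blast
  qed
  have "inj_on g {L. lattice val L \<and> scale 1 M \<subseteq> L \<and> L \<subseteq> M}"
  proof (rule inj_onI, elim CollectE conjE)
    fix L L'
    assume "lattice val L" "scale 1 M \<subseteq> L" "L \<subseteq> M" "lattice val L'" "scale 1 M \<subseteq> L'" "L' \<subseteq> M" "g L = g L'"
    then show "L = L'"
      using sub[of L L'] sub[of L' L] by simp
  qed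
  moreover have "finite (g ` {L. lattice val L \<and> scale 1 M \<subseteq> L \<and> L \<subseteq> M})"
    by (rule finite_subset[of _ "Pow (S \<times> S)"]) (use S(1) in \<open>auto simp: g_def\<close>)
  ultimately show ?thesis
    using finite_imageD by blast
qed

text \<open>This ensures that the sum in \<open>hecke_T\<close> is a genuine finite sum and not the
  default value 0.\<close>

lemma finite_index_p_sub_below: "lattice val v \<Longrightarrow> finite {w. index_p_sub val w v}"
  by (rule finite_subset[OF _ finite_between[of v]])
    (use index_p_sub_scale_subset index_p_sub_lattice in blast)+

lemma finite_index_p_sub_above:
  assumes "lattice val w"
  shows "finite {v. lattice val v \<and> index_p_sub val w v}"
proof (rule finite_subset[OF _ finite_between[OF lattice_scale[OF assms, of "- 1"]]])
  have "scale (1 + - 1) w \<subseteq> v \<and> v \<subseteq> scale (- 1) w" if "lattice val v" "index_p_sub val w v" for v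
    using index_p_sub_scale_subset[OF that(2,1)] scale_subset_iff[of 1 v w] by simp
  then show "{v. lattice val v \<and> index_p_sub val w v} \<subseteq>
      {L. lattice val L \<and> scale 1 (scale (- 1) w) \<subseteq> L \<and> L \<subseteq> scale (- 1) w}"
    by auto
qed


section \<open>Favourite children and iterated ancestors\<close>

lemma parent_scale: "parent w v \<Longrightarrow> parent (scale k w) (scale k v)"
  using index_p_sub_lattice[of w v] by (auto simp: parent_def index_p_sub_scale lattice_scale lev_scale)

lemma parent_lev: "parent w v \<Longrightarrow> lev v = lev w + 1"
  by (simp add: parent_def)

lemma parent_lattice: "parent w v \<Longrightarrow> lattice val w" "parent w v \<Longrightarrow> lattice val v"
  by (auto simp: parent_def index_p_sub_lattice)

text \<open>Choosing a child on lattices of depth 0 only makes the choice commute with scaling.\<close>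
definition fav :: "('a \<times> 'a) set \<Rightarrow> ('a \<times> 'a) set" where
  "fav w = scale (depth w) (SOME v. parent (scale (- depth w) w) v)"

lemma parent_fav:
  assumes "lattice val w"
  shows "parent w (fav w)"
proof -
  have "parent (scale (- depth w) w) (SOME v. parent (scale (- depth w) w) v)"
    using child_exists[OF lattice_scale[OF assms]] by (rule someI_ex)
  then show ?thesis
    using parent_scale[of "scale (- depth w) w" _ "depth w"] by (simp add: fav_def)
qed

lemma fav_scale: "lattice val w \<Longrightarrow> fav (scale k w) = scale k (fav w)"
  by (simp add: fav_def depth_scale add.commute)

lemma lattice_fav_pow: "lattice val w \<Longrightarrow> lattice val ((fav ^^ m) w)"
  by (induction m) (simp_all add: parent_lattice(2)[OF parent_fav])

lemma parent_fav_pow: "lattice val w \<Longrightarrow> (parent ^^ m) w ((fav ^^ m) w)"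
  by (induction m) (auto intro!: relcomppI parent_fav lattice_fav_pow)

lemma parent_pow_lev: "(parent ^^ m) w v \<Longrightarrow> lev v = lev w + m"
proof (induction m arbitrary: v)
  case (Suc m)
  then obtain u where "(parent ^^ m) w u" "parent u v"
    by (elim relpowp_Suc_E)
  then show ?case
    using Suc.IH[of u] parent_lev by simp
qed auto

lemma parent_pow_unique: "(parent ^^ m) w v \<Longrightarrow> (parent ^^ m) w' v \<Longrightarrow> w = w'"
proof (induction m arbitrary: v)
  case (Suc m)
  then obtain u u' where "(parent ^^ m) w u" "parent u v" "(parent ^^ m) w' u'" "parent u' v"
    by (elim relpowp_Suc_E)
  then show ?case
    using Suc.IH parent_unique by blast
qed auto

section \<open>The Hecke operators on indicators of lattices\<close>

lemma hecke_R_pow_eq: "hecke_R_pow unif k \<phi> = (\<lambda>v. \<phi> (scale (- k) v))"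
proof -
  have R: "hecke_R unif = (\<lambda>\<phi> v. \<phi> (scale (- 1) v))" and R': "hecke_R_inv unif = (\<lambda>\<phi> v. \<phi> (scale 1 v))"
    by (simp_all add: fun_eq_iff hecke_R_def hecke_R_inv_def scale_def)
  have "(hecke_R unif ^^ n) \<phi> = (\<lambda>v. \<phi> (scale (- int n) v))"
    "(hecke_R_inv unif ^^ n) \<phi> = (\<lambda>v. \<phi> (scale (int n) v))" for n
    by (induction n) (simp_all add: R R' algebra_simps)
  then show ?thesis
    by (simp add: hecke_R_pow_def)
qed

lemma hecke_R_pow_ind: "hecke_R_pow unif k (ind w) = ind (scale k w)"
  by (auto simp: hecke_R_pow_eq ind_def fun_eq_iff scale_eq_iff)

text \<open>The image is supported on lattices lying directly above the support of
  \<open>\<phi>\<close>, and each lattice has finitely many above it.\<close>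

lemma hecke_T_Cc:
  fixes \<phi> :: "('a \<times> 'a) set \<Rightarrow> 'r::comm_ring_1"
  assumes "\<phi> \<in> Cc val"
  shows "hecke_T val \<phi> \<in> Cc val"
proof -
  have "{v. hecke_T val \<phi> v \<noteq> 0} \<subseteq> (\<Union>w\<in>{w. \<phi> w \<noteq> 0}. {v. lattice val v \<and> index_p_sub val w v})"
  proof
    fix v assume "v \<in> {v. hecke_T val \<phi> v \<noteq> 0}"
    then have "lattice val v" "(\<Sum>w\<in>{w. index_p_sub val w v}. \<phi> w) \<noteq> 0"
      by (auto simp: hecke_T_def split: if_splits)
    moreover then obtain w where "index_p_sub val w v" "\<phi> w \<noteq> 0"
      by (elim sum.not_neutral_contains_not_neutral) blast
    ultimately show "v \<in> (\<Union>w\<in>{w. \<phi> w \<noteq> 0}. {v. lattice val v \<and> index_p_sub val w v})"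
      by blast
  qed
  moreover have "finite (\<Union>w\<in>{w. \<phi> w \<noteq> 0}. {v. lattice val v \<and> index_p_sub val w v})"
    using assms finite_index_p_sub_above by (auto simp: Cc_def)
  ultimately show ?thesis
    by (auto simp: Cc_def hecke_T_def intro: finite_subset split: if_splits)
qed

lemma hecke_T_pow_Cc: "\<phi> \<in> Cc val \<Longrightarrow> (hecke_T val ^^ m) \<phi> \<in> Cc val"
  by (induction m) (auto simp: hecke_T_Cc)

lemma ind_Cc: "lattice val w \<Longrightarrow> ind w \<in> Cc val"
  by (auto simp: Cc_def ind_def)

text \<open>Induction on \<open>m\<close>: one application of \<open>T\<close> raises the level by
  at most one. At the top level the only sublattice that can contribute is the parent, so the
  coefficient is 1 or 0 according to whether \<open>w\<close> is the \<open>m\<close>-th ancestor of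
  \<open>v\<close>.\<close>

lemma
  fixes w :: "('a \<times> 'a) set"
  defines "\<psi> m \<equiv> (hecke_T val ^^ m) (ind w) :: ('a \<times> 'a) set \<Rightarrow> 'r::comm_ring_1"
  assumes w: "lattice val w"
  shows hecke_T_pow_lev_le: "\<psi> m v \<noteq> 0 \<Longrightarrow> lev v \<le> lev w + m"
    and hecke_T_pow_top: "lattice val v \<Longrightarrow> lev v = lev w + m \<Longrightarrow> \<psi> m v = of_bool ((parent ^^ m) w v)"
proof -
  have "(\<psi> m v \<noteq> 0 \<longrightarrow> lev v \<le> lev w + m) \<and>
    (lattice val v \<longrightarrow> lev v = lev w + m \<longrightarrow> \<psi> m v = of_bool ((parent ^^ m) w v))" for v
  proof (induction m arbitrary: v)
    case 0
    show ?case
      by (auto simp: \<psi>_def ind_def)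
  next
    case (Suc m)
    have \<psi>: "\<psi> (Suc m) v = (\<Sum>u\<in>{u. index_p_sub val u v}. \<psi> m u)" if "lattice val v"
      using that by (simp add: \<psi>_def hecke_T_def)
    have "lev v \<le> lev w + Suc m" if nz: "\<psi> (Suc m) v \<noteq> 0"
    proof -
      have v: "lattice val v"
        using nz by (auto simp: \<psi>_def hecke_T_def split: if_splits)
      then have "(\<Sum>u\<in>{u. index_p_sub val u v}. \<psi> m u) \<noteq> 0"
        using nz \<psi> by simp
      then obtain u where "index_p_sub val u v" "\<psi> m u \<noteq> 0"
        by (elim sum.not_neutral_contains_not_neutral) blast
      then show ?thesis
        using Suc.IH[of u] index_p_sub_lev_cases[of u v] v by auto
    qed
    moreover have "\<psi> (Suc m) v = of_bool ((parent ^^ Suc m) w v)"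
      if v: "lattice val v" and lev_v: "lev v = lev w + Suc m"
    proof -
      obtain u where u: "parent u v"
        using parent_exists[OF v] lev_v by auto
      \<comment> \<open>A sublattice other than the parent has level \<open>lev w + m + 2\<close>,
        beyond the support of \<open>\<psi> m\<close>.\<close>
      have "\<psi> m u' = 0" if "index_p_sub val u' v" "u' \<noteq> u" for u'
      proof -
        have "\<not> parent u' v"
          using that u parent_unique by blast
        then have "lev u' = lev v + 1"
          using that v index_p_sub_lev_cases by (auto simp: parent_def)
        then show ?thesis
          using Suc.IH[of u'] lev_v by fastforce
      qed
      then have "\<psi> (Suc m) v = \<psi> m u"
        unfolding \<psi>[OF v] using finite_index_p_sub_below[OF v] u
        by (subst sum.remove[of _ u]) (auto simp: parent_def)
      also have "\<dots> = of_bool ((parent ^^ m) w u)"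
        using Suc.IH[of u] lev_v parent_lattice(1)[OF u] parent_lev[OF u] by simp
      also have "(parent ^^ m) w u \<longleftrightarrow> (parent ^^ Suc m) w v"
        using u parent_unique by auto
      finally show ?thesis .
    qed
    ultimately show ?case
      by blast
  qed
  then show "\<psi> m v \<noteq> 0 \<Longrightarrow> lev v \<le> lev w + m"
    "lattice val v \<Longrightarrow> lev v = lev w + m \<Longrightarrow> \<psi> m v = of_bool ((parent ^^ m) w v)"
    by blast+
qed

section \<open>Roots, leading lattices and triangularity\<close>

definition roots :: "('a \<times> 'a) set set" where
  "roots = {b. lattice val b \<and> depth b = 0 \<and> b \<notin> fav ` {w. lattice val w}}"

text \<open>The lattice at which \<open>T ^ m R ^ k\<close> applied to the indicator of
  \<open>b\<close> has its leading coefficient 1.\<close>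

definition node :: "('a \<times> 'a) set \<Rightarrow> nat \<times> int \<Rightarrow> ('a \<times> 'a) set" where
  "node b mk = (fav ^^ fst mk) (scale (snd mk) b)"

lemma lattice_node: "b \<in> roots \<Longrightarrow> lattice val (node b mk)"
  by (simp add: roots_def node_def lattice_fav_pow lattice_scale)

text \<open>Induction on the level: a favourite child reduces to its parent, and any other lattice
  becomes a root after scaling to depth 0, because \<open>fav\<close> commutes with scaling.\<close>

lemma node_surj: "lattice val v \<Longrightarrow> \<exists>b\<in>roots. \<exists>mk. v = node b mk"
proof (induction "lev v" arbitrary: v rule: less_induct)
  case less
  show ?case
  proof (cases "v \<in> fav ` {w. lattice val w}")
    case True
    then obtain w where w: "lattice val w" "v = fav w"
      by blast
    then have "lev w < lev v"
      using parent_fav[of w] by (simp add: parent_def)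
    then obtain b m k where "b \<in> roots" "w = node b (m, k)"
      using less.hyps[of w] w by auto
    then have "b \<in> roots" "v = node b (Suc m, k)"
      using w by (simp_all add: node_def)
    then show ?thesis
      by blast
  next
    case False
    define b where "b = scale (- depth v) v"
    have v: "v = scale (depth v) b"
      by (simp add: b_def)
    have "b \<notin> fav ` {w. lattice val w}"
    proof
      assume "b \<in> fav ` {w. lattice val w}"
      then obtain w where "lattice val w" "b = fav w"
        by blast
      then have "v = fav (scale (depth v) w)" "lattice val (scale (depth v) w)"
        using v fav_scale lattice_scale by auto
      then show False
        using False by blast
    qed
    then have "b \<in> roots"
      using less.prems by (simp add: roots_def b_def lattice_scale depth_scale)
    moreover have "v = node b (0, depth v)"
      using v by (simp add: node_def)
    ultimately show ?thesis
      by blast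
  qed
qed

lemma mono_act_ind: "mono_act val unif m k (ind b) = (hecke_T val ^^ m) (ind (scale k b))"
  by (simp add: mono_act_def hecke_R_pow_ind)

lemma lev_node: "b \<in> roots \<Longrightarrow> lev (node b mk) = lev b + fst mk"
  using parent_pow_lev[OF parent_fav_pow[OF lattice_scale]] by (auto simp: node_def roots_def lev_scale)

lemma mono_act_node:
  assumes "b \<in> roots"
  shows "mono_act val unif m k (ind b) (node b (m, k)) = (1 :: 'r::comm_ring_1)"
  using assms hecke_T_pow_top[OF lattice_scale, of b "node b (m, k)" k m]
  by (simp add: lattice_node lev_node roots_def mono_act_ind lev_scale)
    (simp add: node_def parent_fav_pow lattice_scale)

text \<open>Lattices of lower level have smaller rank. At equal level the rank compares the numbers
  of favourite steps. If \<open>m \<le> m'\<close>, the \<open>m\<close>-th ancestor of the node is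
  both \<open>scale k b\<close> and a lattice on the favourite path from \<open>b'\<close>; since
  \<open>b\<close> is a root, that path has length 0.\<close>

lemma mono_act_triangular:
  assumes b: "b \<in> roots" and b': "b' \<in> roots"
    and nz: "mono_act val unif m k (ind b) (node b' (m', k')) \<noteq> (0 :: 'r::comm_ring_1)"
  shows "(b', m', k') = (b, m, k) \<or> (lev b' + m', m') < (lev b + m, m)"
proof -
  have lat: "lattice val (scale k b)" "lattice val (scale k' b')"
    using b b' by (simp_all add: roots_def lattice_scale)
  have lev: "lev (scale k b) = lev b" "lev (scale k' b') = lev b'"
    using b b' by (simp_all add: roots_def lev_scale)
  have "lev b' + m' \<le> lev b + m"
    using hecke_T_pow_lev_le[OF lat(1)] nz lev lev_node[OF b'] by (metis mono_act_ind fst_conv)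
  moreover have "(b', m', k') = (b, m, k)" if eq: "lev b' + m' = lev b + m" and "m \<le> m'"
  proof -
    obtain j where j: "m' = m + j"
      using \<open>m \<le> m'\<close> le_Suc_ex by blast
    define u where "u = (fav ^^ j) (scale k' b')"
    have "lattice val u"
      unfolding u_def using lat lattice_fav_pow by blast
    moreover have "node b' (m', k') = (fav ^^ m) u"
      by (simp add: node_def u_def j funpow_add)
    moreover have "(parent ^^ m) (scale k b) (node b' (m', k'))"
      using hecke_T_pow_top[OF lat(1) lattice_node[OF b'], of "(m', k')" m, where ?'r = 'r] nz eq
      by (auto simp: mono_act_ind lev lev_node b' simp del: relpowp.simps)
    ultimately have u: "scale k b = u"
      using parent_pow_unique parent_fav_pow by metis
    \<comment> \<open>Otherwise \<open>scale k b\<close>, and after rescaling \<open>b\<close>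
      itself, would be a favourite child.\<close>
    have "j = 0"
    proof (rule ccontr)
      assume "j \<noteq> 0"
      then obtain i where i: "j = Suc i"
        using not0_implies_Suc by blast
      let ?w = "(fav ^^ i) (scale k' b')"
      have w: "lattice val ?w"
        using lat lattice_fav_pow by blast
      have "b = scale (- k) (fav ?w)"
        using u by (simp add: u_def i scale_eq_iff)
      then have "b = fav (scale (- k) ?w)"
        using w by (simp add: fav_scale)
      then show False
        using b w lattice_scale by (auto simp: roots_def)
    qed
    then have eq: "scale k b = scale k' b'"
      using u by (simp add: u_def)
    \<comment> \<open>Roots have depth 0, so comparing depths recovers the exponent
      \<open>k\<close>, and then the root.\<close>
    then have "depth b + k = depth b' + k'"
      using b b' depth_scale by (metis (mono_tags, lifting) roots_def mem_Collect_eq)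
    then have "k = k'"
      using b b' by (simp add: roots_def)
    then show ?thesis
      using eq j \<open>j = 0\<close> by (simp add: scale_eq_iff)
  qed
  ultimately show ?thesis
    by (auto simp: less_prod_def)
qed

section \<open>Freeness over the Hecke algebra\<close>

theorem free_over_TR: "free_over_TR val unif (Cc val :: (('a \<times> 'a) set \<Rightarrow> 'r::comm_ring_1) set)"
proof -
  let ?B = "ind ` roots :: (('a \<times> 'a) set \<Rightarrow> 'r) set"
  let ?f = "\<lambda>(\<beta>, mk). mono_act val unif (fst mk) (snd mk) \<beta> :: ('a \<times> 'a) set \<Rightarrow> 'r"
  \<comment> \<open>Coefficients are indexed by basis functions, so the underlying lattice is
    recovered with \<open>inv ind\<close>, which is faithful on indicators by
    \<open>inj_ind\<close>.\<close>
  let ?lead = "\<lambda>(\<beta> :: ('a \<times> 'a) set \<Rightarrow> 'r, mk). node (inv ind \<beta>) mk"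
  let ?rank = "\<lambda>(\<beta> :: ('a \<times> 'a) set \<Rightarrow> 'r, mk :: nat \<times> int). (lev (inv ind \<beta>) + fst mk, fst mk)"
  let ?I = "?B \<times> (UNIV :: (nat \<times> int) set)"
  have inv_ind: "inv (ind :: _ \<Rightarrow> _ \<Rightarrow> 'r) (ind b) = b" for b :: "('a \<times> 'a) set"
    by (simp add: inj_ind)
  have lead: "?lead ` ?I = {v. lattice val v}"
    using node_surj by (force simp: inv_ind lattice_node image_iff)
  have f_Cc: "?f i \<in> Cc val" if "i \<in> ?I" for i
    using that by (auto simp: mono_act_ind roots_def intro!: hecke_T_pow_Cc ind_Cc lattice_scale)
  have basis: "\<exists>!c. finite {i. c i \<noteq> 0} \<and> (\<forall>i. c i \<noteq> 0 \<longrightarrow> i \<in> ?I) \<and>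
    \<phi> = (\<lambda>x. \<Sum>i\<in>{i. c i \<noteq> 0}. c i * ?f i x)" if \<phi>: "\<phi> \<in> Cc val" for \<phi>
  proof (rule triangular_basis[where lead = ?lead and rank = ?rank])
    show "finite {x. ?f i x \<noteq> 0}" "?f i x \<noteq> 0 \<Longrightarrow> x \<in> ?lead ` ?I" if "i \<in> ?I" for i x
      using f_Cc[OF that] unfolding lead by (auto simp: Cc_def)
    show "?f i (?lead i) = 1" if "i \<in> ?I" for i
      using that by (auto simp: inv_ind mono_act_node)
    show "j = i \<or> ?rank j < ?rank i" if ij: "i \<in> ?I" "j \<in> ?I" "?f i (?lead j) \<noteq> 0" for i j
    proof -
      obtain b m k b' m' k' where "i = (ind b, (m, k))" "j = (ind b', (m', k'))" "b \<in> roots" "b' \<in> roots"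
        using ij(1,2) by (cases i; cases j) auto
      then show ?thesis
        using ij(3) mono_act_triangular[of b b' m k m' k', where ?'r = 'r] by (auto simp: inv_ind)
    qed
    show "finite {x. \<phi> x \<noteq> 0}" "\<phi> x \<noteq> 0 \<Longrightarrow> x \<in> ?lead ` ?I" for x
      using \<phi> unfolding lead by (auto simp: Cc_def)
  qed
  show ?thesis
    unfolding free_over_TR_def
  proof (intro exI[of _ ?B] conjI ballI)
    show "?B \<subseteq> Cc val"
      by (auto simp: roots_def ind_Cc)
    fix \<phi> :: "('a \<times> 'a) set \<Rightarrow> 'r" assume "\<phi> \<in> Cc val"
    let ?P = "\<lambda>c. finite {i. c i \<noteq> 0} \<and> (\<forall>i. c i \<noteq> 0 \<longrightarrow> i \<in> ?I) \<and>
      \<phi> = (\<lambda>x. \<Sum>i\<in>{i. c i \<noteq> 0}. c i * ?f i x)"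
    let ?Q = "\<lambda>c. finite {(b, mk). c b mk \<noteq> 0} \<and> (\<forall>b mk. c b mk \<noteq> 0 \<longrightarrow> b \<in> ?B) \<and>
      \<phi> = (\<lambda>v. \<Sum>(b, mk)\<in>{(b, mk). c b mk \<noteq> 0}. c b mk * mono_act val unif (fst mk) (snd mk) b v)"
    \<comment> \<open>Freeness is phrased with curried coefficients, the triangular basis with
      coefficients on pairs; \<open>case_prod\<close> and \<open>curry\<close> transport both
      existence and uniqueness.\<close>
    have iff: "?Q c \<longleftrightarrow> ?P (case_prod c)" for c
      by (simp add: case_prod_unfold)
    obtain c where c: "?P c" "\<And>d. ?P d \<Longrightarrow> d = c"
      using basis[OF \<open>\<phi> \<in> Cc val\<close>] by (elim ex1E) blast
    show "\<exists>!c. ?Q c"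
    proof (rule ex1I[of _ "curry c"])
      show "?Q (curry c)"
        unfolding iff using c(1) by simp
      show "d = curry c" if "?Q d" for d
        using c(2)[of "case_prod d"] that unfolding iff by auto
    qed
  qed
qed

end

theorem theorem2p6:
  fixes p :: nat and val :: "'a::field_char_0 \<Rightarrow> int" and unif :: 'a
  assumes "p_adic_field p val"
    and "unif \<noteq> 0" and "val unif = 1"
  shows "free_over_TR val unif (Cc val :: (('a \<times> 'a) set \<Rightarrow> 'r::comm_ring_1) set)"
proof -
  interpret val_field val unif
    using assms by unfold_locales (auto simp: p_adic_field_def)
  show ?thesis
    by (rule free_over_TR)
qed

end
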